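(* Let $h>0$, $s\ge 1$, and let $u,v$ be the polynomials of degree at most $s$ and $\lambda_1,\dots,\lambda_s\in\mathbb{R}^\nu$ vectors such that $$\dot u(ch)=M^{-1}\sum_{j=0}^{s-1}P_j(c)\gamma_j(v),\quad u(0)=q_0,\qquad \dot v(ch)=\sum_{j=0}^{s-1}P_j(c)\psi_j(u)-\sum_{j=1}^{s}\ell_j(c)\,\nabla g(u(c_jh))\lambda_j,\quad v(0)=p_0,\qquad c\in[0,1].$$ Set $q_1:=u(h)$. Then $g(q_1)=0$, provided that $$\nabla g(u(c_ih))^\top M^{-1}v(c_ih)=0\in\mathbb{R}^\nu,\qquad i=1,\dots,s.$$
   Context: Problem. Let $1\le\nu\le m$, let $M\in\mathbb{R}^{m\times m}$ be symmetric positive definite, let $U$ be a real-valued function analytic on an open set $D\subseteq\mathbb{R}^m$ (the domain of interest, in which all position values considered lie), and let $g:\mathbb{R}^m\to\mathbb{R}^\nu$ have quadratic polynomial entries. $\nabla g(q)\in\mathbb{R}^{m\times\nu}$ is the matrix whose columns are the gradients of the entries of $g$. It is assumed that $\nabla g(q)^\top M^{-1}\nabla g(q)$ is symmetric positive definite for $q\in D$, with smallest eigenvalue bounded away from $0$. The constrained Hamiltonian problem is $\dot q=M^{-1}p$, $\dot p=\nabla U(q)-\nabla g(q)\lambda$, $g(q)=0$, with consistent initial values $q(0)=q_0$, $p(0)=p_0$: $g(q_0)=0$ and $\nabla g(q_0)^\top M^{-1}p_0=0$. Notation. $P_j$, $j\ge0$, is the Legendre polynomial of degree $j$ shifted to $[0,1]$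 and scaled so that $\int_0^1P_iP_j\,dx=\delta_{ij}$; $0<c_1<\dots<c_s<1$ are the zeros of $P_s$; $\ell_1,\dots,\ell_s$ are the Lagrange basis polynomials (degree $s-1$) on the nodes $c_1,\dots,c_s$. The dot denotes the derivative with respect to time $t=ch\in[0,h]$. For functions $u,v$ on $[0,h]$, $\gamma_j(v)=\int_0^1P_j(\zeta)v(\zeta h)\,d\zeta$ and $\psi_j(u)=\int_0^1P_j(\zeta)\nabla U(u(\zeta h))\,d\zeta$. *)

theory Defs
  imports "HOL-Analysis.Analysis" "HOL-Computational_Algebra.Polynomial"
begin

text \<open>Rodrigues' formula gives the classical Legendre polynomials on $[-1,1]$, whose squared
  $L^2$ norm is $2/(2j+1)$. Substituting $2x-1$ halves the squared norm, so the factor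
  $\sqrt{2j+1}$ makes the shifted polynomials orthonormal on $[0,1]$.\<close>

definition legendre :: "nat \<Rightarrow> real poly" where
  "legendre j = smult (1 / (2 ^ j * fact j)) ((pderiv ^^ j) ([:-1, 0, 1:] ^ j))"

definition shifted_legendre :: "nat \<Rightarrow> real poly" where
  "shifted_legendre j = smult (sqrt (2 * real j + 1)) (pcompose (legendre j) [:-1, 2:])"

definition lagrange_basis :: "nat \<Rightarrow> (nat \<Rightarrow> real) \<Rightarrow> nat \<Rightarrow> real \<Rightarrow> real" where
  "lagrange_basis s c j x = (\<Prod>i\<in>{1..s} - {j}. (x - c i) / (c j - c i))"

definition poly_curve :: "nat \<Rightarrow> (real \<Rightarrow> real ^ 'm) \<Rightarrow> bool" where
  "poly_curve s u \<longleftrightarrow> (\<forall>i. \<exists>p. degree p \<le> s \<and> (\<forall>t. u t $ i = poly p t))"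

text \<open>Multi-indices are functions from the coordinate type to the naturals; \<open>has_sum\<close> is
  unconditional, hence absolute, convergence.\<close>

definition real_analytic_on :: "(real ^ 'm \<Rightarrow> real) \<Rightarrow> (real ^ 'm) set \<Rightarrow> bool" where
  "real_analytic_on f D \<longleftrightarrow>
     (\<forall>x\<in>D. \<exists>r>0. \<exists>a :: ('m \<Rightarrow> nat) \<Rightarrow> real. \<forall>y\<in>ball x r.
        ((\<lambda>\<alpha>. a \<alpha> * (\<Prod>i\<in>UNIV. (y $ i - x $ i) ^ \<alpha> i)) has_sum f y) UNIV)"

text \<open>Quadratic means of degree at most two: the matrix \<open>A\<close> may vanish.\<close>

definition quadratic_polynomial :: "(real ^ 'm \<Rightarrow> real) \<Rightarrow> bool" where
  "quadratic_polynomial f \<longleftrightarrow>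
     (\<exists>(A :: real ^ 'm ^ 'm) b d. \<forall>q. f q = q \<bullet> (A *v q) + b \<bullet> q + d)"

definition gradient :: "(real ^ 'm \<Rightarrow> real) \<Rightarrow> real ^ 'm \<Rightarrow> real ^ 'm" where
  "gradient f q = (\<chi> i. frechet_derivative f (at q) (axis i 1))"

text \<open>In \<open>real ^ 'n ^ 'm\<close> the outer index \<open>'m\<close> counts rows, so the gradients below are the
  columns; this is the transpose of the Jacobian matrix.\<close>

definition gradient_matrix :: "(real ^ 'm \<Rightarrow> real ^ 'n) \<Rightarrow> real ^ 'm \<Rightarrow> real ^ 'n ^ 'm" where
  "gradient_matrix g q = (\<chi> i k. gradient (\<lambda>x. g x $ k) q $ i)"

definition sym_pos_def :: "real ^ 'n ^ 'n \<Rightarrow> bool" where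
  "sym_pos_def A \<longleftrightarrow> transpose A = A \<and> (\<forall>x. x \<noteq> 0 \<longrightarrow> 0 < x \<bullet> (A *v x))"

text \<open>Only meaningful if \<open>A\<close> has a real eigenvalue, for instance if \<open>A\<close> is symmetric.\<close>

definition smallest_eigenvalue :: "real ^ 'n ^ 'n \<Rightarrow> real" where
  "smallest_eigenvalue A = Min {\<mu>. \<exists>x. x \<noteq> 0 \<and> A *v x = \<mu> *\<^sub>R x}"

definition legendre_coeff :: "real \<Rightarrow> nat \<Rightarrow> (real \<Rightarrow> real ^ 'm) \<Rightarrow> real ^ 'm" where
  "legendre_coeff h j v = integral {0..1} (\<lambda>\<zeta>. poly (shifted_legendre j) \<zeta> *\<^sub>R v (\<zeta> * h))"

end

theory Submission
  imports Defs
begin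

text \<open>
  Write \<open>P\<^sub>j\<close> for the shifted Legendre polynomials and \<open>W\<close> for the polynomial
  \<open>\<Sum>j<s. P\<^sub>j(x) \<gamma>\<^sub>j(v)\<close>, so that \<open>du/dt = M\<^sup>-\<^sup>1 W\<close> at time \<open>t = x h\<close>. Two facts about
  the zeros of \<open>P\<^sub>s\<close> give the theorem.

  Because the \<open>P\<^sub>j\<close> are orthonormal, \<open>W\<close> is the \<open>L\<^sup>2\<close> projection of \<open>v(x h)\<close> onto the polynomials
  of degree less than \<open>s\<close>. As \<open>v\<close> has degree at most \<open>s\<close>, the two differ by a multiple of
  \<open>P\<^sub>s\<close>, and therefore they agree at the zeros of \<open>P\<^sub>s\<close>
  (\<open>legendre_projection_poly_curve\<close>).

  A component \<open>f\<close> of \<open>g\<close> is quadratic, so its gradient is affine and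
  \<open>F(x) = \<nabla>f(u(x h)) \<bullet> M\<^sup>-\<^sup>1 W(x)\<close> is a polynomial of degree at most \<open>s + (s - 1) = 2s - 1\<close>. At the zeros of
  \<open>P\<^sub>s\<close> one may replace \<open>W\<close> by \<open>v\<close>, and the hidden constraints say that \<open>F\<close> vanishes there. So
  \<open>F\<close> is \<open>P\<^sub>s\<close> times a polynomial of degree less than \<open>s\<close>, and its integral over
  the unit interval is zero by orthogonality
  (\<open>integral_eq_0_if_vanishes_at_legendre_roots\<close>; this is the exactness of Gauss quadrature,
  without the weights). Since \<open>h F\<close> is the derivative of \<open>f(u(x h))\<close>, it follows that
  \<open>f(u(h)) = f(u(0)) = 0\<close> (\<open>quadratic_invariant\<close>).
\<close>

section \<open>Integrals of polynomials over the unit interval\<close>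

lemma poly_integrable: "poly (p::real poly) integrable_on {0..1}"
  by (intro integrable_continuous_real continuous_intros)

lemma integral_pderiv:
  "integral {0..1} (poly (pderiv p)) = poly p 1 - poly p (0::real)"
proof (rule integral_unique[OF fundamental_theorem_of_calculus])
  show "(poly p has_vector_derivative poly (pderiv p) x) (at x within {0..1})" for x
    using poly_DERIV[of p x] has_field_derivative_at_within
      has_real_derivative_iff_has_vector_derivative by blast
qed simp

lemma integral_poly_add:
  "integral {0..1} (poly (p + q :: real poly)) = integral {0..1} (poly p) + integral {0..1} (poly q)"
  unfolding poly_add using integral_add[OF poly_integrable poly_integrable] by simp

lemma integral_poly_smult:
  "integral {0..1} (poly (smult k p :: real poly)) = k * integral {0..1} (poly p)"
proof -
  have "poly (smult k p) = (\<lambda>x. k * poly p x)" by auto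
  then show ?thesis by simp
qed

lemma integral_poly_sum:
  "finite A \<Longrightarrow> integral {0..1} (poly (\<Sum>j\<in>A. f j :: real poly)) = (\<Sum>j\<in>A. integral {0..1} (poly (f j)))"
  by (induction A rule: finite_induct) (simp, simp add: integral_poly_add del: poly_add)

text \<open>Integration by parts; the hypotheses are the vanishing of the boundary terms.\<close>

lemma integral_pderiv_mult:
  assumes "poly p 0 * poly q 0 = 0" "poly p 1 * poly q 1 = (0::real)"
  shows "integral {0..1} (poly (pderiv p * q)) = - integral {0..1} (poly (p * pderiv q))"
proof -
  have "integral {0..1} (poly (p * pderiv q)) + integral {0..1} (poly (pderiv p * q)) = 0"
    using integral_pderiv[of "p * q"] assms
    by (simp add: pderiv_mult flip: integral_poly_add) (simp add: mult.commute)
  then show ?thesis by linarith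
qed

text \<open>Each differentiation lowers the multiplicity of a factor by at most one. This makes the
  boundary terms vanish when Rodrigues' formula is integrated by parts.\<close>

lemma power_dvd_higher_pderiv:
  fixes p f :: "real poly"
  assumes "p ^ (n + k) dvd f"
  shows "p ^ n dvd (pderiv ^^ k) f"
  using assms
proof (induction k arbitrary: f)
  case (Suc k)
  then obtain r where r: "f = p ^ Suc (n + k) * r" by (auto simp: dvd_def)
  have "pderiv f = p ^ (n + k) * (p * pderiv r + smult (of_nat (Suc (n+k))) (pderiv p) * r)"
    unfolding r pderiv_mult pderiv_power_Suc by (simp add: algebra_simps)
  then have "p ^ (n + k) dvd pderiv f" by simp
  from Suc.IH[OF this] show ?case by (simp add: funpow_swap1 del: funpow.simps add: funpow_Suc_right)
qed simp

section \<open>Orthonormality of the shifted Legendre polynomials\<close>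

text \<open>The polynomial \<open>x\<^sup>2 - x\<close>: up to the factor 4, this is \<open>t\<^sup>2 - 1\<close> from Rodrigues' formula under the
  substitution \<open>t = 2x - 1\<close>.\<close>

abbreviation parabola :: "real poly" where "parabola \<equiv> [:0, -1, 1:]"

text \<open>The parabola power has zeros of order \<open>n\<close> at both ends of the unit interval, so up to \<open>n\<close>
  derivatives move to the other factor without boundary terms.\<close>

lemma integral_higher_pderiv_mult:
  assumes "k \<le> n"
  shows "integral {0..1} (poly ((pderiv ^^ k) (parabola ^ n) * q))
       = (-1) ^ k * integral {0..1} (poly (parabola ^ n * (pderiv ^^ k) q))"
  using assms
proof (induction k arbitrary: q)
  case (Suc k)
  have "parabola dvd (pderiv ^^ k) (parabola ^ n)"
    using power_dvd_higher_pderiv[of parabola 1 k "parabola ^ n"] Suc.prems by (simp add: le_imp_power_dvd del: power_Suc)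
  then have 0: "poly ((pderiv ^^ k) (parabola ^ n)) 0 = 0" "poly ((pderiv ^^ k) (parabola ^ n)) 1 = 0"
    by (auto simp: dvd_def)
  have "integral {0..1} (poly ((pderiv ^^ Suc k) (parabola ^ n) * q))
      = - integral {0..1} (poly ((pderiv ^^ k) (parabola ^ n) * pderiv q))"
    using integral_pderiv_mult[of "(pderiv ^^ k) (parabola ^ n)" q] 0 by simp
  with Suc.IH[of "pderiv q"] Suc.prems show ?case
    by (simp add: funpow_swap1 del: poly_mult)
qed simp

text \<open>The Beta integral at integer arguments. Integration by parts moves one factor from
  \<open>1 - x\<close> to \<open>x\<close>, so the induction is on the exponent of \<open>1 - x\<close>.\<close>

lemma integral_beta:
  "integral {0..1} (poly ([:0, 1:] ^ a * [:1, -1:] ^ b)) = fact a * fact b / (fact (a + b + 1) :: real)"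
proof (induction b arbitrary: a)
  case 0
  let ?p = "smult (1 / real (Suc a)) ([:0, 1:] ^ Suc a)"
  have "pderiv ?p = [:0, 1:] ^ a"
    unfolding pderiv_smult pderiv_power_Suc by (simp add: pderiv_pCons del: of_nat_Suc)
  with integral_pderiv[of ?p]
  have "integral {0..1} (poly ([:0, 1:] ^ a)) = 1 / real (Suc a)"
    by (simp add: poly_power)
  then show ?case
    by (simp only: power_0 mult_1_right fact_0 add_0_right Suc_eq_plus1[symmetric] fact_Suc) simp
next
  case (Suc b)
  let ?x = "[:0, 1:] :: real poly" and ?y = "[:1, -1:] :: real poly"
  have dx: "pderiv (?x ^ Suc a) = smult (real (Suc a)) (?x ^ a)"
    unfolding pderiv_power_Suc by (simp add: pderiv_pCons del: of_nat_Suc)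
  have dy: "pderiv (?y ^ Suc b) = smult (- real (Suc b)) (?y ^ b)"
    unfolding pderiv_power_Suc by (simp add: pderiv_pCons del: of_nat_Suc)
  have "integral {0..1} (poly (pderiv (?x ^ Suc a) * ?y ^ Suc b))
      = - integral {0..1} (poly (?x ^ Suc a * pderiv (?y ^ Suc b)))"
    by (rule integral_pderiv_mult) (simp_all add: poly_power)
  then have "real (Suc a) * integral {0..1} (poly (?x ^ a * ?y ^ Suc b))
      = real (Suc b) * integral {0..1} (poly (?x ^ Suc a * ?y ^ b))"
    unfolding dx dy mult_smult_left mult_smult_right integral_poly_smult by linarith
  also have "\<dots> = real (Suc b) * (fact (Suc a) * fact b / fact (Suc a + b + 1))"
    unfolding Suc.IH ..
  also have "\<dots> = real (Suc a) * (fact a * fact (Suc b) / fact (a + Suc b + 1))"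
    by (simp only: fact_Suc add_Suc_right add_Suc of_nat_mult of_nat_fact times_divide_eq_right mult.assoc mult.left_commute)
  finally show ?case
    by (metis mult_left_cancel of_nat_neq_0)
qed

lemma integral_parabola_power:
  "integral {0..1} (poly (parabola ^ n)) = (-1) ^ n * (fact n)\<^sup>2 / (fact (2 * n + 1) :: real)"
proof -
  have "parabola = smult (-1) ([:0, 1:] * [:1, -1:])" by simp
  then have "parabola ^ n = smult ((-1) ^ n) ([:0, 1:] ^ n * [:1, -1:] ^ n)"
    by (simp only: smult_power power_mult_distrib)
  then show ?thesis
    using integral_beta[of n n] by (simp only: integral_poly_smult power2_eq_square mult_2 times_divide_eq_right)
qed

text \<open>Rodrigues' formula on the unit interval: the chain rule for \<open>n\<close> derivatives
  gives \<open>2\<^sup>-\<^sup>n\<close>, which with \<open>4\<^sup>n\<close> from the substituted power cancels the \<open>2\<^sup>n\<close> of the classical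
  normalisation.\<close>

lemma shifted_legendre_eq:
  "shifted_legendre n = smult (sqrt (2 * real n + 1) / fact n) ((pderiv ^^ n) (parabola ^ n))"
proof -
  let ?l = "[:-1, 2:] :: real poly"
  have "(pderiv ^^ k) (pcompose p ?l) = smult (2 ^ k) (pcompose ((pderiv ^^ k) p) ?l)" for k and p :: "real poly"
    by (induction k) (simp_all add: pderiv_smult pderiv_pcompose pderiv_pCons mult.commute)
  moreover have pow: "pcompose (p ^ k) ?l = pcompose p ?l ^ k" for k and p :: "real poly"
    by (induction k) (simp_all add: pcompose_mult pcompose_1)
  moreover have "pcompose [:-1, 0, 1:] ?l = smult 4 parabola"
    by (simp add: pcompose_pCons)
  ultimately have "smult (2 ^ n) (pcompose ((pderiv ^^ n) ([:-1, 0, 1:] ^ n)) ?l)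
      = smult (4 ^ n) ((pderiv ^^ n) (parabola ^ n))"
    by (metis pow smult_power higher_pderiv_smult)
  moreover have "(4::real) ^ n = 2 ^ n * 2 ^ n"
    by (metis power_mult_distrib num_double numeral_times_numeral)
  ultimately have "pcompose ((pderiv ^^ n) ([:-1, 0, 1:] ^ n)) ?l
    = smult (2 ^ n) ((pderiv ^^ n) (parabola ^ n))"
    by (metis smult_smult smult_cancel power_not_zero zero_neq_numeral)
  then show ?thesis
    unfolding shifted_legendre_def legendre_def by (simp add: pcompose_smult)
qed

lemma degree_parabola_power: "degree (parabola ^ n) = 2 * n"
  by (simp add: degree_power_eq)

lemma degree_shifted_legendre: "degree (shifted_legendre n) = n"
  unfolding shifted_legendre_eq by (simp add: degree_higher_pderiv degree_parabola_power)

lemma shifted_legendre_nonzero: "shifted_legendre n \<noteq> 0"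
proof -
  have "coeff ((pderiv ^^ n) (parabola ^ n)) n = pochhammer (real (Suc n)) n * lead_coeff (parabola ^ n)"
    unfolding coeff_higher_pderiv degree_parabola_power mult_2 ..
  also have "\<dots> \<noteq> 0"
    unfolding lead_coeff_power using pochhammer_pos[of "real (Suc n)" n] by simp
  finally show ?thesis unfolding shifted_legendre_eq by auto
qed

text \<open>Integrating Rodrigues' formula by parts \<open>n\<close> times differentiates \<open>q\<close> to zero.\<close>

lemma shifted_legendre_orthogonal:
  assumes "degree q < n"
  shows "integral {0..1} (poly (shifted_legendre n * q)) = 0"
proof -
  have "(pderiv ^^ n) q = 0"
    by (rule poly_eqI) (use assms in \<open>simp add: coeff_higher_pderiv coeff_eq_0\<close>)
  then show ?thesis
    unfolding shifted_legendre_eq mult_smult_left integral_poly_smult integral_higher_pderiv_mult[OF order_refl]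
    using integral_poly_smult[of 0 0] by simp
qed

text \<open>The same integration by parts leaves the constant \<open>(2n)!\<close>, the \<open>2n\<close>-th derivative of a
  monic polynomial of degree \<open>2n\<close>, times a Beta integral.\<close>

lemma shifted_legendre_norm:
  "integral {0..1} (poly (shifted_legendre n * shifted_legendre n)) = 1"
proof -
  have D: "(pderiv ^^ n) ((pderiv ^^ n) (parabola ^ n)) = [:fact (2 * n):]"
  proof (rule poly_eqI)
    fix k
    have "coeff (parabola ^ n) (2 * n) = 1"
      using lead_coeff_power[of parabola n] by (simp add: degree_parabola_power)
    moreover have "coeff (parabola ^ n) (Suc k + 2 * n) = 0" for k
      by (rule coeff_eq_0) (simp add: degree_parabola_power)
    moreover have "(pderiv ^^ n) ((pderiv ^^ n) (parabola ^ n)) = (pderiv ^^ (2 * n)) (parabola ^ n)"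
      by (simp add: mult_2 funpow_add)
    ultimately show "coeff ((pderiv ^^ n) ((pderiv ^^ n) (parabola ^ n))) k = coeff [:fact (2 * n):] k"
      by (cases k) (simp_all add: coeff_higher_pderiv pochhammer_fact)
  qed
  define k where "k = sqrt (2 * real n + 1) / fact n"
  have kk: "k * k = (2 * real n + 1) / (fact n)\<^sup>2"
    by (simp only: k_def times_divide_times_eq real_sqrt_mult_self power2_eq_square)
  have "integral {0..1} (poly (shifted_legendre n * shifted_legendre n))
      = k * (k * ((-1) ^ n * (fact (2 * n) * integral {0..1} (poly (parabola ^ n)))))"
    unfolding shifted_legendre_eq k_def[symmetric] mult_smult_left mult_smult_right integral_poly_smult
      integral_higher_pderiv_mult[OF order_refl] D
    by (simp add: integral_poly_smult)
  also have "\<dots> = k * k * ((-1) ^ n * (-1) ^ n) * (fact n)\<^sup>2 * (fact (2 * n) / fact (2 * n + 1))"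
    unfolding integral_parabola_power by simp
  also note kk
  also have "fact (2 * n) / fact (2 * n + 1) = 1 / (2 * real n + 1)"
    by (simp add: add.commute)
  also have "(2 * real n + 1) / (fact n)\<^sup>2 * ((-1) ^ n * (-1) ^ n) * (fact n)\<^sup>2 * (1 / (2 * real n + 1)) = 1"
    by (simp flip: power_mult_distrib)
  finally show ?thesis .
qed

text \<open>There is one Legendre polynomial in each degree, so leading terms can be removed one by one.\<close>

lemma shifted_legendre_expansion:
  "degree p < n \<Longrightarrow> \<exists>a. p = (\<Sum>j<n. smult (a j) (shifted_legendre j))"
proof (induction n arbitrary: p)
  case (Suc n)
  let ?P = "shifted_legendre n"
  define k where "k = coeff p n / coeff ?P n"
  define r where "r = p - smult k ?P"
  have "degree r \<le> n"
    unfolding r_def using Suc.prems by (intro degree_diff_le) (auto simp: degree_shifted_legendre)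
  have "coeff r n = 0"
    using leading_coeff_neq_0[OF shifted_legendre_nonzero[of n], unfolded degree_shifted_legendre]
    by (simp add: r_def k_def)
  show ?case
  proof (cases "r = 0")
    case True
    then show ?thesis
      by (intro exI[of _ "\<lambda>j. if j = n then k else 0"])
        (simp add: r_def if_distrib[of "\<lambda>x. smult x _"] cong: if_cong)
  next
    case False
    then have "degree r \<noteq> n" using \<open>coeff r n = 0\<close> by auto
    with \<open>degree r \<le> n\<close> Suc.IH[of r] obtain a where a: "r = (\<Sum>j<n. smult (a j) (shifted_legendre j))"
      by auto
    then show ?thesis
      by (intro exI[of _ "a(n := k)"]) (simp add: r_def algebra_simps)
  qed
qed simp

lemma shifted_legendre_orthonormal:
  "integral {0..1} (poly (shifted_legendre i * shifted_legendre j)) = (if i = j then 1 else 0)"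
proof (cases i j rule: linorder_cases)
  case less
  then show ?thesis
    using shifted_legendre_orthogonal[of "shifted_legendre i" j]
    by (simp add: degree_shifted_legendre mult.commute)
next
  case greater
  then show ?thesis
    using shifted_legendre_orthogonal[of "shifted_legendre j" i]
    by (simp add: degree_shifted_legendre)
qed (simp add: shifted_legendre_norm)

section \<open>The zeros of a shifted Legendre polynomial as nodes\<close>

text \<open>The expansion of \<open>p\<close> in Legendre polynomials has at most one term beyond the projection, a multiple of
  \<open>P\<^sub>s\<close>, which vanishes at the root.\<close>

lemma legendre_projection_at_root:
  assumes "degree p \<le> s" and root: "poly (shifted_legendre s) x = 0"
  shows "(\<Sum>j<s. poly (shifted_legendre j) x * integral {0..1} (poly (shifted_legendre j * p))) = poly p x"
proof -
  obtain a where a: "p = (\<Sum>i<Suc s. smult (a i) (shifted_legendre i))"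
    using shifted_legendre_expansion[of p "Suc s"] assms by auto
  have "integral {0..1} (poly (shifted_legendre j * p)) = a j" if "j < s" for j
  proof -
    have "integral {0..1} (poly (shifted_legendre j * p))
        = (\<Sum>i<Suc s. a i * (if j = i then 1 else 0))"
      unfolding a sum_distrib_left mult_smult_right
      by (subst integral_poly_sum) (simp_all only: finite_lessThan integral_poly_smult shifted_legendre_orthonormal)
    also have "\<dots> = (\<Sum>i<Suc s. if j = i then a i else 0)"
      by (intro sum.cong) auto
    also have "\<dots> = a j" using that by simp
    finally show ?thesis .
  qed
  then have "(\<Sum>j<s. poly (shifted_legendre j) x * integral {0..1} (poly (shifted_legendre j * p)))
      = (\<Sum>j<s. a j * poly (shifted_legendre j) x)"
    by (intro sum.cong) auto
  also have "\<dots> = poly p x"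
    unfolding a by (simp add: poly_sum root)
  finally show ?thesis .
qed

text \<open>The remainder of \<open>f\<close> modulo \<open>P\<^sub>s\<close> has degree less than \<open>s\<close> and \<open>s\<close> distinct zeros, so
  \<open>P\<^sub>s\<close> divides \<open>f\<close>; the quotient has degree less than \<open>s\<close> and is orthogonal to \<open>P\<^sub>s\<close>.\<close>

lemma integral_eq_0_if_vanishes_at_legendre_roots:
  assumes roots: "card {x. poly (shifted_legendre s) x = 0} = s"
    and deg: "degree f < 2 * s"
    and f: "\<And>x. poly (shifted_legendre s) x = 0 \<Longrightarrow> poly f x = 0"
  shows "integral {0..1} (poly f) = 0"
proof -
  let ?P = "shifted_legendre s"
  let ?r = "f mod ?P"
  have fdm: "f = ?P * (f div ?P) + ?r" by simp
  have "?r = 0"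
  proof (rule ccontr)
    assume "?r \<noteq> 0"
    have "{x. poly ?P x = 0} \<subseteq> {x. poly ?r x = 0}"
    proof clarify
      fix x assume "poly ?P x = 0"
      with f have "poly (?P * (f div ?P) + ?r) x = 0" by simp
      with \<open>poly ?P x = 0\<close> show "poly ?r x = 0" unfolding poly_add poly_mult by simp
    qed
    then have "s \<le> card {x. poly ?r x = 0}"
      using card_mono[OF poly_roots_finite[OF \<open>?r \<noteq> 0\<close>]] roots by metis
    also have "\<dots> \<le> degree ?r" by (rule card_poly_roots_bound[OF \<open>?r \<noteq> 0\<close>])
    also have "\<dots> < s"
      using degree_mod_less'[OF shifted_legendre_nonzero \<open>?r \<noteq> 0\<close>] by (simp add: degree_shifted_legendre)
    finally show False by simp
  qed
  then have eq: "f = ?P * (f div ?P)" using fdm by simp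
  have "degree (f div ?P) < s"
  proof (cases "f div ?P = 0")
    case False
    with eq have "degree f = s + degree (f div ?P)"
      using degree_mult_eq[OF shifted_legendre_nonzero False] by (metis degree_shifted_legendre)
    with deg show ?thesis by simp
  qed (use deg in simp)
  then show ?thesis
    using shifted_legendre_orthogonal eq by metis
qed

section \<open>Quadratic invariants along a polynomial curve\<close>

lemma quadratic_polynomial_gradient:
  fixes f :: "real ^ 'm \<Rightarrow> real"
  assumes "quadratic_polynomial f"
  obtains B :: "real ^ 'm ^ 'm" and b where "\<And>q. gradient f q = B *v q + b"
    and "\<And>q. (f has_derivative (\<lambda>w. gradient f q \<bullet> w)) (at q)"
proof -
  obtain A :: "real ^ 'm ^ 'm" and b d where f: "f = (\<lambda>q. q \<bullet> (A *v q) + b \<bullet> q + d)"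
    using assms unfolding quadratic_polynomial_def by blast
  \<comment> \<open>\<open>A\<close> need not be symmetric, so both \<open>A\<close> and its transpose contribute.\<close>
  let ?G = "\<lambda>q. (A + transpose A) *v q + b"
  have D: "(f has_derivative (\<lambda>w. ?G q \<bullet> w)) (at q)" for q
  proof -
    have "(f has_derivative (\<lambda>w. q \<bullet> (A *v w) + w \<bullet> (A *v q) + b \<bullet> w)) (at q)"
      unfolding f by (auto intro!: derivative_eq_intros bounded_linear_imp_has_derivative)
    moreover have "q \<bullet> (A *v w) = (transpose A *v q) \<bullet> w" for w
      by (metis dot_lmul_matrix transpose_matrix_vector)
    ultimately show ?thesis
      by (simp add: matrix_vector_mult_add_rdistrib inner_add_left inner_add_right inner_commute add_ac)
  qed
  have "gradient f q = ?G q" for q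
    unfolding gradient_def frechet_derivative_at[OF D, symmetric]
    by (simp add: vec_eq_iff inner_axis)
  with D that show ?thesis by metis
qed

lemma poly_curve_rescale:
  assumes "poly_curve s u"
  obtains P where "\<And>i. degree (P i) \<le> s" and "\<And>x i. poly (P i) x = u (x * h) $ i"
proof -
  from assms obtain p where p: "\<And>i. degree (p i) \<le> s" "\<And>i t. u t $ i = poly (p i) t"
    unfolding poly_curve_def by metis
  have "degree (pcompose (p i) [:0, h:]) \<le> s" for i
    using degree_pcompose_le[of "p i" "[:0, h:]"] p(1)[of i] by (auto split: if_splits)
  moreover have "poly (pcompose (p i) [:0, h:]) x = u (x * h) $ i" for x i
    by (simp add: poly_pcompose p)
  ultimately show thesis by (rule that)
qed

text \<open>At the nodes, the truncated Legendre series driving \<open>u\<close> has the same value as \<open>v\<close> itself, which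
  is how conditions on \<open>v\<close> become conditions on the derivative of \<open>u\<close>.\<close>

lemma legendre_projection_poly_curve:
  assumes v: "poly_curve s v" and root: "poly (shifted_legendre s) x = 0"
  shows "(\<Sum>j<s. poly (shifted_legendre j) x *\<^sub>R legendre_coeff h j v) = v (x * h)"
proof -
  obtain V where V: "\<And>i. degree (V i) \<le> s" "\<And>x i. poly (V i) x = v (x * h) $ i"
    using poly_curve_rescale[OF v] by blast
  have comp: "(\<lambda>x. (poly (shifted_legendre j) x *\<^sub>R v (x * h)) $ i) = poly (shifted_legendre j * V i)" for i j
    by (simp add: V fun_eq_iff)
  have "(\<lambda>x. poly (shifted_legendre j) x *\<^sub>R v (x * h)) integrable_on {0..1}" for j
    by (subst integrable_componentwise_iff)
      (use comp in \<open>auto simp: Basis_vec_def inner_axis poly_integrable\<close>)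
  from integral_component_eq_cart[OF this]
  have coeff: "legendre_coeff h j v $ i = integral {0..1} (poly (shifted_legendre j * V i))" for i j
    unfolding legendre_coeff_def comp[symmetric] by (rule sym)
  show ?thesis
  proof (rule vec_eq_iff[THEN iffD2], rule allI)
    fix i
    have "(\<Sum>j<s. poly (shifted_legendre j) x *\<^sub>R legendre_coeff h j v) $ i
        = (\<Sum>j<s. poly (shifted_legendre j) x * integral {0..1} (poly (shifted_legendre j * V i)))"
      by (simp only: sum_component vector_scaleR_component real_scaleR_def coeff)
    also have "\<dots> = v (x * h) $ i"
      unfolding legendre_projection_at_root[OF V(1) root] V(2) ..
    finally show "(\<Sum>j<s. poly (shifted_legendre j) x *\<^sub>R legendre_coeff h j v) $ i = v (x * h) $ i" .
  qed
qed

text \<open>The increment of \<open>f\<close> along \<open>u\<close> is the integral of a polynomial \<open>F\<close> of degree less than \<open>2 * s\<close>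
  that vanishes at the nodes. That the gradient is affine is what keeps the degree this low.\<close>

lemma quadratic_invariant:
  fixes f :: "real ^ 'm \<Rightarrow> real" and u v :: "real \<Rightarrow> real ^ 'm" and A :: "real ^ 'm ^ 'm"
  assumes f: "quadratic_polynomial f" and s: "s \<ge> 1"
    and roots: "card {x. poly (shifted_legendre s) x = 0} = s"
    and u: "poly_curve s u" and v: "poly_curve s v"
    and u_deriv: "\<And>x. x \<in> {0..1} \<Longrightarrow>
        (u has_vector_derivative
          A *v (\<Sum>j<s. poly (shifted_legendre j) x *\<^sub>R legendre_coeff h j v)) (at (x * h))"
    and tangent: "\<And>x. poly (shifted_legendre s) x = 0 \<Longrightarrow>
        gradient f (u (x * h)) \<bullet> (A *v v (x * h)) = 0"
  shows "f (u h) = f (u 0)"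
proof -
  obtain B :: "real ^ 'm ^ 'm" and b where grad: "\<And>q. gradient f q = B *v q + b"
    and D: "\<And>q. (f has_derivative (\<lambda>w. gradient f q \<bullet> w)) (at q)"
    using quadratic_polynomial_gradient[OF f] by blast
  obtain Q where Q: "\<And>i. degree (Q i) \<le> s" "\<And>x i. poly (Q i) x = u (x * h) $ i"
    using poly_curve_rescale[OF u] by blast
  \<comment> \<open>The integrand is assembled from component polynomials, so that its degree can be bounded.\<close>
  define W where "W x = (\<Sum>j<s. poly (shifted_legendre j) x *\<^sub>R legendre_coeff h j v)" for x
  define w where "w i = (\<Sum>j<s. smult (legendre_coeff h j v $ i) (shifted_legendre j))" for i
  define N where "N i = (\<Sum>j\<in>UNIV. smult (B $ i $ j) (Q j)) + [:b $ i:]" for i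
  define F where "F = (\<Sum>i\<in>UNIV. N i * (\<Sum>l\<in>UNIV. smult (A $ i $ l) (w l)))"
  have w: "poly (w i) x = W x $ i" for i x
    by (simp add: w_def W_def poly_sum mult.commute)
  have N: "poly (N i) x = gradient f (u (x * h)) $ i" for i x
    by (simp add: N_def grad poly_sum Q(2) matrix_vector_mult_def)
  have F: "poly F x = gradient f (u (x * h)) \<bullet> (A *v W x)" for x
    by (simp add: F_def poly_sum w N inner_vec_def matrix_vector_mult_def)
  have "degree (w i) \<le> s - 1" for i
    unfolding w_def using s
    by (intro degree_sum_le) (auto intro!: order_trans[OF degree_smult_le] simp: degree_shifted_legendre)
  then have "degree (\<Sum>l\<in>UNIV. smult (A $ i $ l) (w l)) \<le> s - 1" for i
    by (intro degree_sum_le) (auto intro: order_trans[OF degree_smult_le])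
  moreover have "degree (N i) \<le> s" for i
    unfolding N_def using Q(1)
    by (intro degree_add_le degree_sum_le) (auto intro: order_trans[OF degree_smult_le])
  ultimately have "degree F \<le> s + (s - 1)"
    unfolding F_def by (intro degree_sum_le) (auto intro!: order_trans[OF degree_mult_le] add_mono)
  then have "degree F < 2 * s" using s by simp
  moreover have "poly F x = 0" if "poly (shifted_legendre s) x = 0" for x
    using tangent[OF that] legendre_projection_poly_curve[OF v that] by (simp add: F W_def)
  ultimately have "integral {0..1} (poly F) = 0"
    using integral_eq_0_if_vanishes_at_legendre_roots[OF roots] by blast
  moreover have "((\<lambda>x. f (u (x * h))) has_vector_derivative h * poly F x) (at x within {0..1})"
    if "x \<in> {0..1}" for x
  proof -
    have "((\<lambda>x. x * h) has_vector_derivative h) (at x)"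
      by (auto intro!: derivative_eq_intros)
    from vector_diff_chain_at[OF this u_deriv[OF that]]
    have "((\<lambda>x. u (x * h)) has_derivative (\<lambda>t. t *\<^sub>R h *\<^sub>R (A *v W x))) (at x)"
      by (simp add: o_def W_def has_vector_derivative_def)
    from has_derivative_compose[OF this D]
    have "((\<lambda>x. f (u (x * h))) has_derivative (\<lambda>t. t *\<^sub>R (h * poly F x))) (at x)"
      by (simp add: F mult.assoc)
    then show ?thesis
      unfolding has_vector_derivative_def by (rule has_derivative_at_withinI)
  qed
  then have "((\<lambda>x. h * poly F x) has_integral f (u (1 * h)) - f (u (0 * h))) {0..1}"
    by (intro fundamental_theorem_of_calculus) auto
  then have "h * integral {0..1} (poly F) = f (u h) - f (u 0)"
    by (simp add: integral_unique flip: integral_mult_right)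
  ultimately show ?thesis by simp
qed

theorem theorem2:
  fixes M :: "real ^ 'm ^ 'm"
    and D :: "(real ^ 'm) set"
    and U :: "real ^ 'm \<Rightarrow> real"
    and g :: "real ^ 'm \<Rightarrow> real ^ 'n"
    and q0 p0 q1 :: "real ^ 'm"
    and h :: real
    and s :: nat
    and c :: "nat \<Rightarrow> real"
    and u v :: "real \<Rightarrow> real ^ 'm"
    and lam :: "nat \<Rightarrow> real ^ 'n"
  assumes dims: "CARD('n) \<le> CARD('m)"
    and M: "sym_pos_def M"
    and D: "open D"
    and U: "real_analytic_on U D"
    and g: "\<And>k. quadratic_polynomial (\<lambda>q. g q $ k)"
    and constraint_spd:
      "\<And>q. q \<in> D \<Longrightarrow>
        sym_pos_def (transpose (gradient_matrix g q) ** matrix_inv M ** gradient_matrix g q)"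
    and constraint_eigenvalue:
      "\<exists>\<mu>>0. \<forall>q\<in>D. \<mu> \<le> smallest_eigenvalue
        (transpose (gradient_matrix g q) ** matrix_inv M ** gradient_matrix g q)"
    and q0: "g q0 = 0"
    and p0: "transpose (gradient_matrix g q0) *v (matrix_inv M *v p0) = 0"
    and h: "h > 0"
    and s: "s \<ge> 1"
    and c_mono: "strict_mono_on {1..s} c"
    and c_range: "c ` {1..s} \<subseteq> {0<..<1}"
    and c_zeros: "c ` {1..s} = {x. poly (shifted_legendre s) x = 0}"
    and u_poly: "poly_curve s u"
    and v_poly: "poly_curve s v"
    and u_in_D: "\<And>t. t \<in> {0..h} \<Longrightarrow> u t \<in> D"
    and u_deriv:
      "\<And>x. x \<in> {0..1} \<Longrightarrow>
        (u has_vector_derivative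
          matrix_inv M *v (\<Sum>j<s. poly (shifted_legendre j) x *\<^sub>R legendre_coeff h j v))
        (at (x * h))"
    and u_init: "u 0 = q0"
    and v_deriv:
      "\<And>x. x \<in> {0..1} \<Longrightarrow>
        (v has_vector_derivative
          (\<Sum>j<s. poly (shifted_legendre j) x *\<^sub>R legendre_coeff h j (\<lambda>t. gradient U (u t)))
          - (\<Sum>j=1..s. lagrange_basis s c j x *\<^sub>R (gradient_matrix g (u (c j * h)) *v lam j)))
        (at (x * h))"
    and v_init: "v 0 = p0"
    and q1: "q1 = u h"
    and hidden_constraints:
      "\<And>i. i \<in> {1..s} \<Longrightarrow>
        transpose (gradient_matrix g (u (c i * h))) *v (matrix_inv M *v v (c i * h)) = 0"
  shows "g q1 = 0"
proof -
  have roots: "card {x. poly (shifted_legendre s) x = 0} = s"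
    using card_image[OF strict_mono_on_imp_inj_on[OF c_mono]] unfolding c_zeros by simp
  have "g (u h) $ k = g (u 0) $ k" for k
  proof (rule quadratic_invariant[where f = "\<lambda>q. g q $ k" and h = h and A = "matrix_inv M", OF g s roots u_poly v_poly u_deriv])
    fix x assume "poly (shifted_legendre s) x = 0"
    then obtain i where "i \<in> {1..s}" and x: "x = c i"
      using c_zeros by blast
    have "gradient (\<lambda>q. g q $ k) (u (x * h)) \<bullet> (matrix_inv M *v v (x * h))
        = (transpose (gradient_matrix g (u (x * h))) *v (matrix_inv M *v v (x * h))) $ k"
      unfolding matrix_vector_mult_def[of "transpose _"]
      by (simp add: inner_vec_def transpose_def gradient_matrix_def)
    with hidden_constraints[OF \<open>i \<in> {1..s}\<close>] x
    show "gradient (\<lambda>q. g q $ k) (u (x * h)) \<bullet> (matrix_inv M *v v (x * h)) = 0"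
      by simp
  qed
  then have "g (u h) = g (u 0)" by (simp add: vec_eq_iff)
  with q0 show ?thesis by (simp only: q1 u_init)
qed

end
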